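(* Let $X$ be a nontrivial real Banach space and let $F:X\times X\to\mathbb{R}$ be a monotone bifunction with $F(x,x)=0$ for all $x\in X$. If $D(A^F)=X$ and $F(\cdot,y)$ is upper hemicontinuous for all $y\in X$, then $F$ is maximal monotone.
   Context: $X^*$ is the topological dual of $X$ and $\langle x^*,x\rangle$ the value of $x^*\in X^*$ at $x\in X$. A function is upper hemicontinuous if it is upper semicontinuous on line segments. A bifunction $F:X\times X\to\mathbb{R}$ is monotone if $F(x,y)+F(y,x)\le 0$ for all $x,y\in X$. The operator $A^F:X\rightrightarrows X^*$ is defined by $A^F(x)=\{x^*\in X^*:F(x,y)-F(x,x)\ge\langle x^*,y-x\rangle\ \forall y\in X\}$, and $D(A^F)=\{x\in X:A^F(x)\ne\emptyset\}$. The monotone bifunction $F$ is maximal monotone if $A^F$ is a maximal monotone operator, i.e. $A^F$ is monotone ($\langle y^*-x^*,y-x\rangle\ge 0$ whenever $x^*\in A^F(x)$, $y^*\in A^F(y)$) and its graph is not properly included in the graph of another monotone operator $X\rightrightarrows X^*$. *)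

theory Defs
  imports "HOL-Analysis.Analysis"
begin

definition upper_semicontinuous_on :: "'a::topological_space set \<Rightarrow> ('a \<Rightarrow> real) \<Rightarrow> bool" where
  "upper_semicontinuous_on S f \<longleftrightarrow>
     (\<forall>x\<in>S. \<forall>c. f x < c \<longrightarrow> (\<forall>\<^sub>F y in at x within S. f y < c))"

definition upper_hemicontinuous :: "('a::real_normed_vector \<Rightarrow> real) \<Rightarrow> bool" where
  "upper_hemicontinuous f \<longleftrightarrow> (\<forall>a b. upper_semicontinuous_on (closed_segment a b) f)"

text \<open>
  The topological dual of \<open>'a\<close> is the type \<open>'a \<Rightarrow>\<^sub>L real\<close> of bounded linear functionals, and
  a set-valued operator from \<open>'a\<close> to its dual is a function into sets of functionals.
\<close>

definition operator_graph :: "('a \<Rightarrow> 'b set) \<Rightarrow> ('a \<times> 'b) set" where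
  "operator_graph T = {(x, x'). x' \<in> T x}"

definition operator_domain :: "('a \<Rightarrow> 'b set) \<Rightarrow> 'a set" where
  "operator_domain T = {x. T x \<noteq> {}}"

definition monotone_operator :: "('a::real_normed_vector \<Rightarrow> ('a \<Rightarrow>\<^sub>L real) set) \<Rightarrow> bool" where
  "monotone_operator T \<longleftrightarrow>
     (\<forall>x y. \<forall>x'\<in>T x. \<forall>y'\<in>T y. blinfun_apply (y' - x') (y - x) \<ge> 0)"

definition maximal_monotone_operator ::
    "('a::real_normed_vector \<Rightarrow> ('a \<Rightarrow>\<^sub>L real) set) \<Rightarrow> bool" where
  "maximal_monotone_operator T \<longleftrightarrow>
     monotone_operator T \<and>
     \<not> (\<exists>S. monotone_operator S \<and> operator_graph T \<subset> operator_graph S)"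

definition monotone_bifunction :: "('a \<Rightarrow> 'a \<Rightarrow> real) \<Rightarrow> bool" where
  "monotone_bifunction F \<longleftrightarrow> (\<forall>x y. F x y + F y x \<le> 0)"

definition bifunction_operator ::
    "('a::real_normed_vector \<Rightarrow> 'a \<Rightarrow> real) \<Rightarrow> 'a \<Rightarrow> ('a \<Rightarrow>\<^sub>L real) set" where
  "bifunction_operator F x = {x'. \<forall>y. F x y - F x x \<ge> blinfun_apply x' (y - x)}"

definition maximal_monotone_bifunction :: "('a::real_normed_vector \<Rightarrow> 'a \<Rightarrow> real) \<Rightarrow> bool" where
  "maximal_monotone_bifunction F \<longleftrightarrow>
     monotone_bifunction F \<and> maximal_monotone_operator (bifunction_operator F)"

end

(* Let (u, u') be monotonically related to the graph of A = A^F, fix y and put x(t) = u + t (y - u)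
   for 0 < t < 1.  Since A has full domain, pick x'(t) in A (x(t)).  Monotonicity against (u, u')
   gives <x'(t), y - u> >= <u', y - u>, so F(x(t), y) >= <x'(t), y - x(t)> >= (1 - t) <u', y - u>.
   Upper semicontinuity of F(., y) along the segment, as t tends to 0, yields
   F(u, y) >= <u', y - u>, that is, u' in A u. *)
theory Submission
  imports Defs
begin

text \<open>If \<open>f u\<close> were below \<open>c\<close>, upper semicontinuity at the endpoint
  \<open>u\<close> would keep \<open>f\<close> strictly below \<open>c\<close>, with a gap, near
  \<open>u\<close> on the segment, while the lower bounds tend to \<open>c\<close>.\<close>

lemma upper_hemicontinuous_limit_ge:
  fixes f :: "'a::real_normed_vector \<Rightarrow> real"
  assumes usc: "upper_hemicontinuous f"
    and lower: "\<And>t. \<lbrakk>0 < t; t < 1\<rbrakk> \<Longrightarrow> (1 - t) * c \<le> f (u + t *\<^sub>R (y - u))"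
    and "y \<noteq> u"
  shows "c \<le> f u"
proof (rule ccontr)
  assume "\<not> c \<le> f u"
  \<comment> \<open>The gap on both sides of \<open>d\<close> matters: \<open>f u < d\<close> feeds
    semicontinuity, and \<open>d < c\<close> contradicts the non-strict \<open>c \<le> d\<close>
    that survives the limit.\<close>
  then obtain d where d: "f u < d" "d < c"
    using dense by (auto simp: not_le)
  have less_1: "\<forall>\<^sub>F t in at_right 0. t < (1::real)"
    by (auto simp: eventually_at_right_field intro!: exI[of _ 1])
  define p where "p t = u + t *\<^sub>R (y - u)" for t
  have "\<forall>\<^sub>F x in at u within closed_segment u y. f x < d"
    using usc d(1) unfolding upper_hemicontinuous_def upper_semicontinuous_on_def by simp
  \<comment> \<open>The filter at \<open>u\<close> leaves out \<open>u\<close> itself, so the path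
    must approach \<open>u\<close> inside the segment without hitting it; this uses
    \<open>y \<noteq> u\<close>.\<close>
  moreover have "filterlim p (at u within closed_segment u y) (at_right 0)"
    unfolding filterlim_at
  proof
    have "continuous (at_right 0) p"
      unfolding p_def by (intro continuous_intros)
    then show "(p \<longlongrightarrow> u) (at_right 0)"
      by (simp add: continuous_within p_def)
    show "\<forall>\<^sub>F t in at_right 0. p t \<in> closed_segment u y \<and> p t \<noteq> u"
      using less_1 eventually_at_right_less[of "0::real"]
    proof eventually_elim
      case (elim t)
      then have "p t \<in> closed_segment u y"
        unfolding in_segment p_def by (intro exI[of _ t]) (simp add: algebra_simps)
      then show ?case
        using elim \<open>y \<noteq> u\<close> by (simp add: p_def)
    qed
  qed
  ultimately have "\<forall>\<^sub>F t in at_right 0. f (p t) < d"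
    by (rule eventually_compose_filterlim)
  then have "\<forall>\<^sub>F t in at_right 0. (1 - t) * c \<le> d"
    using less_1 eventually_at_right_less[of "0::real"]
  proof eventually_elim
    case (elim t)
    then show ?case
      using lower[of t] by (simp add: p_def)
  qed
  moreover have "((\<lambda>t. (1 - t) * c) \<longlongrightarrow> c) (at_right 0)"
    by (auto intro!: tendsto_eq_intros)
  ultimately have "c \<le> d"
    using tendsto_upperbound trivial_limit_at_right_real by blast
  with d show False by simp
qed

text \<open>Test each defining inequality at the base point of the other and add: the sum is bounded
  by \<open>F x y + F y x\<close>.\<close>

lemma monotone_operator_bifunction_operator:
  assumes "monotone_bifunction F" "\<And>x. F x x = 0"
  shows "monotone_operator (bifunction_operator F)"
  unfolding monotone_operator_def
proof (intro allI ballI)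
  fix x y x' y'
  assume "x' \<in> bifunction_operator F x" "y' \<in> bifunction_operator F y"
  then have "blinfun_apply x' (y - x) \<le> F x y" "blinfun_apply y' (x - y) \<le> F y x"
    using assms(2) by (auto simp: bifunction_operator_def)
  moreover have "F x y + F y x \<le> 0"
    using assms(1) by (simp add: monotone_bifunction_def)
  ultimately show "0 \<le> blinfun_apply (y' - x') (y - x)"
    by (simp add: blinfun.diff_left blinfun.diff_right)
qed

text \<open>This is maximality in pointwise form, for a single pair \<open>(u, u')\<close> instead
  of a whole extension of the operator.\<close>

lemma monotonically_related_mem_bifunction_operator:
  assumes diag: "\<And>x. F x x = 0"
    and dom: "operator_domain (bifunction_operator F) = UNIV"
    and usc: "\<And>y. upper_hemicontinuous (\<lambda>x. F x y)"
    and related: "\<And>x x'. x' \<in> bifunction_operator F x \<Longrightarrow> 0 \<le> blinfun_apply (x' - u') (x - u)"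
  shows "u' \<in> bifunction_operator F u"
proof -
  have "blinfun_apply u' (y - u) \<le> F u y" for y
  proof (cases "y = u")
    case False
    show ?thesis
    proof (rule upper_hemicontinuous_limit_ge[OF usc _ False])
      fix t :: real
      assume t: "0 < t" "t < 1"
      define x where "x = u + t *\<^sub>R (y - u)"
      obtain x' where x': "x' \<in> bifunction_operator F x"
        using dom by (auto simp: operator_domain_def)
      \<comment> \<open>Since \<open>x - u\<close> is \<open>t\<close> times \<open>y - u\<close>,
        the relation carries a factor \<open>t\<close>, which is positive and cancels.\<close>
      have "0 \<le> t * blinfun_apply (x' - u') (y - u)"
        using related[OF x'] by (simp add: x_def blinfun.scaleR_right)
      then have "blinfun_apply u' (y - u) \<le> blinfun_apply x' (y - u)"
        using t by (simp add: zero_le_mult_iff blinfun.diff_left)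
      \<comment> \<open>The factor \<open>1 - t\<close> turns \<open>y - u\<close> into
        \<open>y - x\<close>, the direction in which membership of \<open>x'\<close> bounds
        \<open>F x y\<close>.\<close>
      then have "(1 - t) * blinfun_apply u' (y - u) \<le> (1 - t) * blinfun_apply x' (y - u)"
        using t by simp
      also have "\<dots> = blinfun_apply x' ((1 - t) *\<^sub>R (y - u))"
        by (simp add: blinfun.scaleR_right)
      also have "(1 - t) *\<^sub>R (y - u) = y - x"
        by (simp add: x_def algebra_simps)
      also have "blinfun_apply x' (y - x) \<le> F x y"
        using x' diag by (simp add: bifunction_operator_def)
      finally show "(1 - t) * blinfun_apply u' (y - u) \<le> F (u + t *\<^sub>R (y - u)) y"
        by (simp add: x_def)
    qed
  qed (simp add: diag)
  then show ?thesis
    by (simp add: bifunction_operator_def diag)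
qed

theorem theorem14:
  fixes F :: "'a::banach \<Rightarrow> 'a \<Rightarrow> real"
  assumes nontrivial: "\<exists>x::'a. x \<noteq> 0"
    and mono: "monotone_bifunction F"
    and diag: "\<And>x. F x x = 0"
    and dom: "operator_domain (bifunction_operator F) = UNIV"
    and usc: "\<And>y. upper_hemicontinuous (\<lambda>x. F x y)"
  shows "maximal_monotone_bifunction F"
proof -
  \<comment> \<open>Every pair of a monotone extension \<open>S\<close> is monotonically related to
    the smaller graph, hence already lies in it, so the inclusion cannot be proper.\<close>
  have "u' \<in> bifunction_operator F u"
    if S: "monotone_operator S" "operator_graph (bifunction_operator F) \<subseteq> operator_graph S"
      and "u' \<in> S u" for S u u'
  proof (rule monotonically_related_mem_bifunction_operator[OF diag dom usc])
    fix x x'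
    assume "x' \<in> bifunction_operator F x"
    then have "x' \<in> S x"
      using S(2) by (auto simp: operator_graph_def)
    then show "0 \<le> blinfun_apply (x' - u') (x - u)"
      using S(1) \<open>u' \<in> S u\<close> by (simp add: monotone_operator_def)
  qed
  then have "\<not> (\<exists>S. monotone_operator S
      \<and> operator_graph (bifunction_operator F) \<subset> operator_graph S)"
    by (auto simp: operator_graph_def)
  then show ?thesis
    using mono monotone_operator_bifunction_operator[OF mono diag]
    by (simp add: maximal_monotone_bifunction_def maximal_monotone_operator_def)
qed

end
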